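(* Let $\{S_k\}_{k\in\mathbb{Z}_+}$ be the NUCC (non-uniform corner-cutting) scheme. Then $\{S_k\}$ is $C^1$, i.e. it is convergent and its limit functions are continuously differentiable on $\mathbb{R}$.
   Context: Notation. $\mathbb{Z}_+$ is the set of nonnegative integers. A (linear) non-uniform subdivision scheme $\{S_k:k\in\mathbb{Z}_+\}$ with finitely supported masks $\mathbf{a}^{j,k}=\{\mathbf{a}^{j,k}_n:n\in\mathbb{Z}\}$ acts on real sequences $\mathbf{g}=\{\mathbf{g}_j:j\in\mathbb{Z}\}$ by $$(S_k\mathbf{g})_{2j+\nu}=\sum_{i\in\mathbb{Z}}\mathbf{a}^{j,k}_{2i+\nu}\,\mathbf{g}_{j-i},\qquad \nu=0,1,\ j\in\mathbb{Z}.$$ The grid points are $t^k_j:=2^{-k}(j-\tfrac12)$ (dual parametrization). $S_{\mathbf a}$ denotes the classical (stationary, uniform) corner-cutting scheme, i.e. the scheme with mask $\mathbf{a}_{-2}=\tfrac14,\ \mathbf{a}_{-1}=\mathbf{a}_0=\tfrac34,\ \mathbf{a}_1=\tfrac14$ (other entries zero) for all $j,k$. The NUCC scheme. Given real initial data $\mathbf{f}^0=\{\mathbf{f}^0_j:j\in\mathbb{Z}\}$, put $\mathbf{d}^0_j:=\mathbf{f}^0_{j-1}-2\mathbf{f}^0_j+\mathbf{f}^0_{j+1}$ and $\mathbf{d}^k:=S_{\mathbf a}^k\mathbf{d}^0$. The operators $S_k$ and data $\mathbf{f}^{k+1}:=S_k\mathbf{f}^k$ are built recursively: for $j\in\mathbb{Z}$,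 $\nu\in\{0,1\}$, let $$\gamma_{2j+\nu}=\gamma_{2j+\nu,k}:=\sqrt{\frac{\mathbf{d}^k_{j+\nu}}{\mathbf{f}^k_{j+\nu}+\epsilon}}$$ (real or purely imaginary), where $\epsilon$ is a nonzero number with $|\epsilon|$ a fixed positive constant and whose sign is that of $\mathbf{f}^k_{j+\nu}$ (either sign if $\mathbf{f}^k_{j+\nu}=0$). The only nonzero entries of the mask $\mathbf{a}^{j,k}$ are $$\mathbf{a}^{j,k}_{-2}=\frac{\sinh(\frac14\gamma_{2j}2^{-k})}{\sinh(\gamma_{2j}2^{-k})},\quad \mathbf{a}^{j,k}_{-1}=\frac{\sinh(\frac34\gamma_{2j+1}2^{-k})}{\sinh(\gamma_{2j+1}2^{-k})},\quad \mathbf{a}^{j,k}_{0}=\frac{\sinh(\frac34\gamma_{2j}2^{-k})}{\sinh(\gamma_{2j}2^{-k})},\quad \mathbf{a}^{j,k}_{1}=\frac{\sinh(\frac14\gamma_{2j+1}2^{-k})}{\sinh(\gamma_{2j+1}2^{-k})},$$ where for $\gamma=0$ the quotients are replaced by their limits $\tfrac14,\tfrac34$. Once $\mathbf{f}^0$ is fixed, the masks are fixed, and $\{S_k\}$ is regarded as a sequence of linear operators. Standing assumptions. The shape parameters $\gamma_{2j+\nu,k}$ are uniformly bounded in $j,\nu,k$, and $\mathbf{a}_n-\tfrac14<\mathbf{a}^{j,k}_n<\mathbf{a}_n+\tfrac14$ for all $j,k$ and $n\in\{-2,-1,0,1\}$. Definitions. A scheme $\{S_k\}$ is convergent if for any initial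 data $\mathbf{g}^0$, with $\mathbf{g}^{k}:=S_{k-1}\cdots S_0\mathbf{g}^0$, there is $g\in C(\mathbb{R})$ (the limit function) such that for every compact $\Omega\subset\mathbb{R}$, $\lim_{k\to\infty}\sup_{j\in\mathbb{Z}\cap 2^k\Omega}|\mathbf{g}^k_j-g(t^k_j)|=0$, and $g\not\equiv0$ for some $\mathbf{g}^0$. A convergent scheme is $C^1$ if all its limit functions belong to $C^1(\mathbb{R})$. *)

theory Defs
  imports "HOL-Analysis.Analysis"
begin

text \<open>
  A mask family at one level is a function \<open>a :: int \<Rightarrow> int \<Rightarrow> real\<close>, where \<open>a j n\<close> is the
  \<open>n\<close>-th entry of the mask used at position \<open>j\<close>. The output index \<open>m\<close> is \<open>2 * j + \<nu>\<close> with
  \<open>j = m div 2\<close> and \<open>\<nu> = m mod 2 \<in> {0, 1}\<close>. The sum ranges over the support of the mask, so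
  it is the full sum over the integers for finitely supported masks.
\<close>

definition subdiv :: "(int \<Rightarrow> int \<Rightarrow> real) \<Rightarrow> (int \<Rightarrow> real) \<Rightarrow> int \<Rightarrow> real" where
  "subdiv a g m =
     (let j = m div 2; \<nu> = m mod 2
      in \<Sum>i | a j (2 * i + \<nu>) \<noteq> 0. a j (2 * i + \<nu>) * g (j - i))"

lemma subdiv_rule:
  assumes "\<nu> \<in> {0, 1}"
  shows "subdiv a g (2 * j + \<nu>) =
           (\<Sum>i | a j (2 * i + \<nu>) \<noteq> 0. a j (2 * i + \<nu>) * g (j - i))"
proof -
  have "(2 * j + \<nu>) div 2 = j" "(2 * j + \<nu>) mod 2 = \<nu>" using assms by auto
  then show ?thesis by (simp add: subdiv_def Let_def)
qed

type_synonym scheme = "nat \<Rightarrow> (int \<Rightarrow> real) \<Rightarrow> (int \<Rightarrow> real)"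

primrec iterates :: "scheme \<Rightarrow> (int \<Rightarrow> real) \<Rightarrow> nat \<Rightarrow> int \<Rightarrow> real" where
  "iterates S g0 0 = g0"
| "iterates S g0 (Suc k) = S k (iterates S g0 k)"

definition grid_point :: "nat \<Rightarrow> int \<Rightarrow> real" where
  "grid_point k j = (real_of_int j - 1/2) / 2 ^ k"

text \<open>
  The supremum is taken in \<^typ>\<open>ennreal\<close> so that it is \<open>0\<close> when no integer lies in
  \<open>2 ^ k \<cdot> \<Omega>\<close>.
\<close>

definition is_limit_function :: "scheme \<Rightarrow> (int \<Rightarrow> real) \<Rightarrow> (real \<Rightarrow> real) \<Rightarrow> bool" where
  "is_limit_function S g0 g \<longleftrightarrow>
     continuous_on UNIV g \<and>
     (\<forall>\<Omega>. compact \<Omega> \<longrightarrow>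
        (\<lambda>k. SUP j \<in> {j. real_of_int j \<in> (\<lambda>x. 2 ^ k * x) ` \<Omega>}.
           ennreal \<bar>iterates S g0 k j - g (grid_point k j)\<bar>) \<longlonglongrightarrow> 0)"

definition convergent_scheme :: "scheme \<Rightarrow> bool" where
  "convergent_scheme S \<longleftrightarrow>
     (\<forall>g0. \<exists>g. is_limit_function S g0 g) \<and>
     (\<exists>g0 g. is_limit_function S g0 g \<and> g \<noteq> (\<lambda>x. 0))"

definition C1_scheme :: "scheme \<Rightarrow> bool" where
  "C1_scheme S \<longleftrightarrow>
     convergent_scheme S \<and>
     (\<forall>g0 g. is_limit_function S g0 g \<longrightarrow> g C1_differentiable_on UNIV)"

definition cc_mask :: "int \<Rightarrow> real" where
  "cc_mask n = (if n = -2 \<or> n = 1 then 1/4 else if n = -1 \<or> n = 0 then 3/4 else 0)"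

definition init_second_diff :: "(int \<Rightarrow> real) \<Rightarrow> int \<Rightarrow> real" where
  "init_second_diff f0 j = f0 (j - 1) - 2 * f0 j + f0 (j + 1)"

definition second_diff_data :: "(int \<Rightarrow> real) \<Rightarrow> nat \<Rightarrow> int \<Rightarrow> real" where
  "second_diff_data f0 k = (subdiv (\<lambda>_. cc_mask) ^^ k) (init_second_diff f0)"

text \<open>
  \<open>sinh_quot r z\<close> is \<open>sinh (r z) / sinh z\<close>, continued to \<open>z = 0\<close>. It is only used for real or
  purely imaginary \<open>z\<close>, where the quotient is real (lemma \<open>of_real_sinh_quot\<close>). At
  the nonzero zeros of \<open>sinh\<close> its value is the junk value \<open>0\<close>; the mask bounds below exclude
  this case because they force the entries with indices \<open>-2\<close> and \<open>1\<close> to be positive.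
\<close>

definition sinh_quot :: "real \<Rightarrow> complex \<Rightarrow> real" where
  "sinh_quot r z = (if z = 0 then r else Re (sinh (of_real r * z) / sinh z))"

lemma of_real_sinh_quot:
  assumes "Im z = 0 \<or> Re z = 0" and "z \<noteq> 0"
  shows "of_real (sinh_quot r z) = sinh (of_real r * z) / sinh z"
proof -
  have cnj_sinh: "cnj (sinh w) = sinh (cnj w)" for w :: complex
    by (simp add: sinh_field_def exp_cnj)
  have "cnj z = z \<or> cnj z = - z"
    using assms(1) by (auto simp: complex_eq_iff)
  then have "cnj (sinh (of_real r * z) / sinh z) = sinh (of_real r * z) / sinh z"
    by (auto simp: cnj_sinh)
  then have "sinh (of_real r * z) / sinh z \<in> \<real>"
    by (simp only: Reals_cnj_iff)
  then show ?thesis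
    using assms(2) by (simp add: sinh_quot_def)
qed

text \<open>
  \<open>shape_param d f e n\<close> is the parameter with index \<open>n = 2 * j + \<nu>\<close>, so that the data index
  \<open>j + \<nu>\<close> is \<open>n div 2 + n mod 2\<close>; \<open>e n\<close> is the number written \<open>\<epsilon>\<close> for this index.
\<close>

definition shape_param ::
    "(int \<Rightarrow> real) \<Rightarrow> (int \<Rightarrow> real) \<Rightarrow> (int \<Rightarrow> real) \<Rightarrow> int \<Rightarrow> complex" where
  "shape_param d f e n =
     (let m = n div 2 + n mod 2 in csqrt (of_real (d m / (f m + e n))))"

definition shape_mask :: "nat \<Rightarrow> (int \<Rightarrow> complex) \<Rightarrow> int \<Rightarrow> int \<Rightarrow> real" where
  "shape_mask k \<gamma> j n =
     (if n = -2 then sinh_quot (1/4) (\<gamma> (2 * j) / 2 ^ k)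
      else if n = -1 then sinh_quot (3/4) (\<gamma> (2 * j + 1) / 2 ^ k)
      else if n = 0 then sinh_quot (3/4) (\<gamma> (2 * j) / 2 ^ k)
      else if n = 1 then sinh_quot (1/4) (\<gamma> (2 * j + 1) / 2 ^ k)
      else 0)"

text \<open>
  In the following definitions \<open>eps k n\<close> is the number \<open>\<epsilon>\<close> used at level \<open>k\<close> for the shape
  parameter with index \<open>n\<close>. It is a parameter, constrained by \<open>admissible_eps\<close>, because its
  sign may be chosen freely wherever the data vanish.
\<close>

primrec nucc_data :: "(nat \<Rightarrow> int \<Rightarrow> real) \<Rightarrow> (int \<Rightarrow> real) \<Rightarrow> nat \<Rightarrow> int \<Rightarrow> real" where
  "nucc_data eps f0 0 = f0"
| "nucc_data eps f0 (Suc k) =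
     subdiv (shape_mask k (shape_param (second_diff_data f0 k) (nucc_data eps f0 k) (eps k)))
       (nucc_data eps f0 k)"

definition nucc_gamma :: "(nat \<Rightarrow> int \<Rightarrow> real) \<Rightarrow> (int \<Rightarrow> real) \<Rightarrow> nat \<Rightarrow> int \<Rightarrow> complex" where
  "nucc_gamma eps f0 k = shape_param (second_diff_data f0 k) (nucc_data eps f0 k) (eps k)"

definition nucc_mask ::
    "(nat \<Rightarrow> int \<Rightarrow> real) \<Rightarrow> (int \<Rightarrow> real) \<Rightarrow> nat \<Rightarrow> int \<Rightarrow> int \<Rightarrow> real" where
  "nucc_mask eps f0 k = shape_mask k (nucc_gamma eps f0 k)"

definition nucc_scheme :: "(nat \<Rightarrow> int \<Rightarrow> real) \<Rightarrow> (int \<Rightarrow> real) \<Rightarrow> scheme" where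
  "nucc_scheme eps f0 k = subdiv (nucc_mask eps f0 k)"

definition admissible_eps ::
    "real \<Rightarrow> (nat \<Rightarrow> int \<Rightarrow> real) \<Rightarrow> (int \<Rightarrow> real) \<Rightarrow> bool" where
  "admissible_eps c eps f0 \<longleftrightarrow>
     (\<forall>k n. \<bar>eps k n\<bar> = c \<and>
        (let m = n div 2 + n mod 2
         in nucc_data eps f0 k m \<noteq> 0 \<longrightarrow> sgn (eps k n) = sgn (nucc_data eps f0 k m)))"

end

theory Submission
  imports Defs
begin

text \<open>
  The argument is asymptotic equivalence with corner cutting. Since \<open>sinh (r z) / sinh z\<close> is even
  and analytic at \<open>0\<close> with value \<open>r\<close> there, and the shape parameters stay bounded, every mask entry
  at level \<open>k\<close> differs from the corner-cutting entry by \<open>O(4\<^sup>-\<^sup>k)\<close> (\<open>shape_mask_near\<close>). Schemes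
  with this property are studied in the locale \<open>perturbed_corner_cutting\<close>.

  Corner cutting maps first differences to averages of halved first differences. Hence the divided
  differences \<open>2\<^sup>k (g\<^sub>j\<^sub>+\<^sub>1 - g\<^sub>j)\<close> are themselves refined by averaging, and their own differences are
  halved at each level. The perturbation changes a first difference by \<open>O(4\<^sup>-\<^sup>k)\<close>, hence a divided
  difference by only \<open>O(2\<^sup>-\<^sup>k)\<close>, which is summable (\<open>slope_refinement\<close>, \<open>slope_geometric\<close>). So both
  the data and the divided differences converge locally uniformly at a geometric rate to continuous
  functions \<open>g\<close> and \<open>h\<close>. Summing divided differences between two grid points and letting the grid
  shrink shows that \<open>h\<close> is the derivative of \<open>g\<close> (\<open>geometric_limit_has_derivative\<close>). The estimates
  are global ones for bounded data; because the masks are local, arbitrary data may be truncated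
  (\<open>iterates_local\<close>).

  A convergent scheme must also have a nonzero limit. The assumed mask bounds make all entries
  positive, and row sums are \<open>1 + O(4\<^sup>-\<^sup>k)\<close>, so the iterates of the constant \<open>1\<close> stay above a
  positive constant (\<open>limit_of_one_positive\<close>): positivity carries the first levels, where the
  perturbation may be large, and summability of \<open>4\<^sup>-\<^sup>k\<close> carries all later ones.
\<close>

section \<open>Limits of data on refining grids\<close>

text \<open>
  Comparing \<open>h t\<close> with all data whose index is within distance \<open>1\<close> of \<open>2\<^sup>k t\<close> makes the notion
  independent of the parametrization: it covers the primal points \<open>j / 2\<^sup>k\<close>, the dual points
  \<open>(j - 1/2) / 2\<^sup>k\<close> and the choice \<open>j = \<lfloor>2\<^sup>k t\<rfloor>\<close> at once.
\<close>

definition geometric_limit :: "real \<Rightarrow> (nat \<Rightarrow> int \<Rightarrow> real) \<Rightarrow> (real \<Rightarrow> real) \<Rightarrow> bool" where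
  "geometric_limit \<rho> u h \<longleftrightarrow>
     (\<forall>R. \<exists>B. \<forall>k j t. \<bar>t\<bar> \<le> R \<longrightarrow> \<bar>2 ^ k * t - real_of_int j\<bar> \<le> 1 \<longrightarrow> \<bar>u k j - h t\<bar> \<le> B * \<rho> ^ k)"

lemma geometric_limitE:
  assumes "geometric_limit \<rho> u h"
  obtains B where "\<And>k j t. \<bar>t\<bar> \<le> R \<Longrightarrow> \<bar>2 ^ k * t - real_of_int j\<bar> \<le> 1 \<Longrightarrow> \<bar>u k j - h t\<bar> \<le> B * \<rho> ^ k"
  using assms unfolding geometric_limit_def by meson

lemma geometric_error_tendsto_0:
  fixes \<rho> :: real
  assumes "0 < \<rho>" "\<rho> < 1"
  shows "(\<lambda>k. B * \<rho> ^ k) \<longlonglongrightarrow> 0"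
  using tendsto_mult[OF tendsto_const LIMSEQ_realpow_zero, of \<rho> B] assms by simp

lemma geometric_steps_converge:
  fixes x :: "nat \<Rightarrow> real"
  assumes "0 < \<rho>" "\<rho> < 1" and step: "\<And>k. \<bar>x (Suc k) - x k\<bar> \<le> B * \<rho> ^ k"
  shows "\<exists>l. \<forall>k. \<bar>x k - l\<bar> \<le> B / (1 - \<rho>) * \<rho> ^ k"
proof -
  have "0 \<le> B" using step[of 0] by simp
  have far: "\<bar>x (k + n) - x k\<bar> \<le> B / (1 - \<rho>) * (\<rho> ^ k - \<rho> ^ (k + n))" for k n
  proof (induction n)
    case (Suc n)
    have "\<bar>x (k + Suc n) - x k\<bar> \<le> B * \<rho> ^ (k + n) + B / (1 - \<rho>) * (\<rho> ^ k - \<rho> ^ (k + n))"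
      using Suc step[of "k + n"] by simp
    also have "\<dots> = B / (1 - \<rho>) * (\<rho> ^ k - \<rho> ^ (k + Suc n))"
      using assms(2) by (simp add: field_simps)
    finally show ?case .
  qed simp
  have bound: "\<bar>x (k + n) - x k\<bar> \<le> B / (1 - \<rho>) * \<rho> ^ k" for k n
  proof -
    have "B / (1 - \<rho>) * (\<rho> ^ k - \<rho> ^ (k + n)) \<le> B / (1 - \<rho>) * \<rho> ^ k"
      using assms \<open>0 \<le> B\<close> by (intro mult_left_mono) auto
    then show ?thesis using far[of k n] by linarith
  qed
  have "summable (\<lambda>k. x (Suc k) - x k)"
    by (rule summable_comparison_test'[where g = "\<lambda>k. B * \<rho> ^ k"])
       (use assms in \<open>auto intro!: summable_mult summable_geometric\<close>)
  then have "(\<lambda>n. \<Sum>i<n. x (Suc i) - x i) \<longlonglongrightarrow> (\<Sum>i. x (Suc i) - x i)"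
    by (rule summable_LIMSEQ)
  then have "(\<lambda>n. x n - x 0) \<longlonglongrightarrow> (\<Sum>i. x (Suc i) - x i)"
    by (simp add: sum_lessThan_telescope)
  then have "(\<lambda>n. x n - x 0 + x 0) \<longlonglongrightarrow> (\<Sum>i. x (Suc i) - x i) + x 0"
    by (intro tendsto_intros)
  then obtain l where "x \<longlonglongrightarrow> l" by auto
  have "\<bar>x k - l\<bar> \<le> B / (1 - \<rho>) * \<rho> ^ k" for k
  proof (rule LIMSEQ_le_const2)
    show "(\<lambda>n. \<bar>x k - x (n + k)\<bar>) \<longlonglongrightarrow> \<bar>x k - l\<bar>"
      by (intro tendsto_intros LIMSEQ_ignore_initial_segment \<open>x \<longlonglongrightarrow> l\<close>)
    show "\<exists>N. \<forall>n\<ge>N. \<bar>x k - x (n + k)\<bar> \<le> B / (1 - \<rho>) * \<rho> ^ k"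
      using bound[of k] by (auto simp: add.commute abs_minus_commute)
  qed
  then show ?thesis by blast
qed

lemma floor_dyadic_Suc:
  "\<lfloor>2 ^ Suc k * t\<rfloor> = 2 * \<lfloor>2 ^ k * t\<rfloor> \<or> \<lfloor>2 ^ Suc k * t\<rfloor> = 2 * \<lfloor>2 ^ k * t\<rfloor> + (1 :: int)" for t :: real
proof -
  have *: "2 ^ Suc k * t = 2 * (2 ^ k * t)" by simp
  show ?thesis unfolding * by linarith
qed

text \<open>
  The binary expansion of \<open>t\<close> is followed: \<open>\<lfloor>2\<^sup>k\<^sup>+\<^sup>1 t\<rfloor>\<close> is one of the two children \<open>2 j\<close>, \<open>2 j + 1\<close> of
  \<open>j = \<lfloor>2\<^sup>k t\<rfloor>\<close>, so small parent-child steps make the data along \<open>t\<close> a Cauchy sequence. Small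
  neighbour steps then extend the estimate to the adjacent indices.
\<close>

lemma geometric_limit_exists:
  assumes \<rho>: "0 < \<rho>" "\<rho> < 1"
    and steps: "\<And>N :: int. 0 \<le> N \<Longrightarrow> \<exists>B. \<forall>k j. - N * 2 ^ k \<le> j \<longrightarrow> j \<le> N * 2 ^ k \<longrightarrow>
          \<bar>u (Suc k) (2 * j) - u k j\<bar> \<le> B * \<rho> ^ k \<and>
          \<bar>u (Suc k) (2 * j + 1) - u k j\<bar> \<le> B * \<rho> ^ k \<and>
          \<bar>u k (j + 1) - u k j\<bar> \<le> B * \<rho> ^ k"
  shows "\<exists>h. geometric_limit \<rho> u h"
proof -
  have local_limits: "\<exists>B. (\<forall>t. \<bar>t\<bar> \<le> R \<longrightarrow> (\<exists>l. \<forall>k. \<bar>u k \<lfloor>2 ^ k * t\<rfloor> - l\<bar> \<le> B * \<rho> ^ k)) \<and>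
      (\<forall>k j t. \<bar>t\<bar> \<le> R \<longrightarrow> \<bar>2 ^ k * t - real_of_int j\<bar> \<le> 1 \<longrightarrow> \<bar>u k j - u k \<lfloor>2 ^ k * t\<rfloor>\<bar> \<le> B * \<rho> ^ k)"
    if "0 \<le> R" for R :: real
  proof -
    \<comment> \<open>The margin \<open>2\<close> leaves room for the floor of \<open>2\<^sup>k t\<close> and for its two neighbours.\<close>
    define N where "N = \<lceil>R\<rceil> + 2"
    have "0 \<le> N" using that by (simp add: N_def)
    obtain B where B: "\<And>k j. - N * 2 ^ k \<le> j \<Longrightarrow> j \<le> N * 2 ^ k \<Longrightarrow>
          \<bar>u (Suc k) (2 * j) - u k j\<bar> \<le> B * \<rho> ^ k \<and>
          \<bar>u (Suc k) (2 * j + 1) - u k j\<bar> \<le> B * \<rho> ^ k \<and>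
          \<bar>u k (j + 1) - u k j\<bar> \<le> B * \<rho> ^ k"
      using steps[OF \<open>0 \<le> N\<close>] by blast
    have "0 \<le> B" using B[of 0 0] \<open>0 \<le> N\<close> by auto
    have window: "- N * 2 ^ k \<le> j" "j \<le> N * 2 ^ k"
      if "\<bar>t\<bar> \<le> R" "\<bar>2 ^ k * t - real_of_int j\<bar> \<le> 2" for t k j
    proof -
      have "\<bar>2 ^ k * t\<bar> \<le> 2 ^ k * R" using that(1) by (simp add: abs_mult)
      moreover have "2 ^ k * R + 2 \<le> 2 ^ k * real_of_int N"
      proof -
        have "2 ^ k * R + 2 \<le> 2 ^ k * (R + 2 :: real)" by (simp add: algebra_simps)
        also have "\<dots> \<le> 2 ^ k * real_of_int N" unfolding N_def by (intro mult_left_mono) auto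
        finally show ?thesis .
      qed
      ultimately have "\<bar>real_of_int j\<bar> \<le> 2 ^ k * real_of_int N" using that(2) by linarith
      then have "\<bar>real_of_int j\<bar> \<le> real_of_int (N * 2 ^ k)" by (simp add: mult.commute)
      then have "\<bar>j\<bar> \<le> N * 2 ^ k" by linarith
      then show "- N * 2 ^ k \<le> j" "j \<le> N * 2 ^ k" by auto
    qed
    have "\<exists>l. \<forall>k. \<bar>u k \<lfloor>2 ^ k * t\<rfloor> - l\<bar> \<le> B / (1 - \<rho>) * \<rho> ^ k" if "\<bar>t\<bar> \<le> R" for t
    proof (rule geometric_steps_converge[OF \<rho>])
      fix k
      have "\<bar>2 ^ k * t - real_of_int \<lfloor>2 ^ k * t\<rfloor>\<bar> \<le> 2" by linarith
      then show "\<bar>u (Suc k) \<lfloor>2 ^ Suc k * t\<rfloor> - u k \<lfloor>2 ^ k * t\<rfloor>\<bar> \<le> B * \<rho> ^ k"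
        using B[OF window[OF that, of k]] floor_dyadic_Suc[of k t] by metis
    qed
    moreover have "B * \<rho> ^ k \<le> B / (1 - \<rho>) * \<rho> ^ k" for k
      using \<rho> \<open>0 \<le> B\<close> by (intro mult_right_mono) (auto simp: field_simps)
    moreover have "\<bar>u k j - u k \<lfloor>2 ^ k * t\<rfloor>\<bar> \<le> B * \<rho> ^ k"
      if "\<bar>t\<bar> \<le> R" "\<bar>2 ^ k * t - real_of_int j\<bar> \<le> 1" for t k j
    proof -
      let ?i = "\<lfloor>2 ^ k * t\<rfloor>"
      have "j = ?i \<or> j = ?i + 1 \<or> ?i = j + 1" using that(2) by linarith
      moreover have "\<bar>u k (?i + 1) - u k ?i\<bar> \<le> B * \<rho> ^ k"
        using B[OF window[OF that(1), of k ?i]] by linarith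
      moreover have "\<bar>u k (j + 1) - u k j\<bar> \<le> B * \<rho> ^ k"
        using B[OF window[OF that(1), of k j]] that(2) by linarith
      moreover have "0 \<le> B * \<rho> ^ k" using \<open>0 \<le> B\<close> \<rho> by simp
      ultimately show ?thesis by (smt (verit))
    qed
    ultimately show ?thesis
      by (meson order_trans)
  qed
  define h where "h t = lim (\<lambda>k. u k \<lfloor>2 ^ k * t\<rfloor>)" for t :: real
  have "geometric_limit \<rho> u h"
    unfolding geometric_limit_def
  proof
    fix R :: real
    obtain B where B1: "\<And>t. \<bar>t\<bar> \<le> \<bar>R\<bar> \<Longrightarrow> \<exists>l. \<forall>k. \<bar>u k \<lfloor>2 ^ k * t\<rfloor> - l\<bar> \<le> B * \<rho> ^ k"
      and B2: "\<And>k j t. \<bar>t\<bar> \<le> \<bar>R\<bar> \<Longrightarrow> \<bar>2 ^ k * t - real_of_int j\<bar> \<le> 1 \<Longrightarrow>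
        \<bar>u k j - u k \<lfloor>2 ^ k * t\<rfloor>\<bar> \<le> B * \<rho> ^ k"
      using local_limits[of "\<bar>R\<bar>"] by auto
    have h: "\<bar>u k \<lfloor>2 ^ k * t\<rfloor> - h t\<bar> \<le> B * \<rho> ^ k" if t: "\<bar>t\<bar> \<le> \<bar>R\<bar>" for k t
    proof -
      obtain l where l: "\<And>k. \<bar>u k \<lfloor>2 ^ k * t\<rfloor> - l\<bar> \<le> B * \<rho> ^ k" using B1[OF t] by blast
      have "(\<lambda>k. u k \<lfloor>2 ^ k * t\<rfloor> - l) \<longlonglongrightarrow> 0"
        by (rule Lim_null_comparison[OF _ geometric_error_tendsto_0[OF \<rho>, of B]]) (use l in auto)
      then have "(\<lambda>k. u k \<lfloor>2 ^ k * t\<rfloor>) \<longlonglongrightarrow> l" by (rule LIM_zero_cancel)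
      then show ?thesis using l unfolding h_def by (simp add: limI)
    qed
    have "\<bar>u k j - h t\<bar> \<le> 2 * B * \<rho> ^ k" if "\<bar>t\<bar> \<le> R" "\<bar>2 ^ k * t - real_of_int j\<bar> \<le> 1" for k j t
      using h[of t k] B2[of t k j] that by linarith
    then show "\<exists>B. \<forall>k j t. \<bar>t\<bar> \<le> R \<longrightarrow> \<bar>2 ^ k * t - real_of_int j\<bar> \<le> 1 \<longrightarrow> \<bar>u k j - h t\<bar> \<le> B * \<rho> ^ k"
      by blast
  qed
  then show ?thesis by blast
qed

lemma geometric_limit_floor:
  assumes \<rho>: "0 < \<rho>" "\<rho> < 1" and u: "geometric_limit \<rho> u h"
  shows "(\<lambda>k. u k \<lfloor>2 ^ k * t\<rfloor>) \<longlonglongrightarrow> h t"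
proof -
  obtain B where B: "\<And>k j s. \<bar>s\<bar> \<le> \<bar>t\<bar> \<Longrightarrow> \<bar>2 ^ k * s - real_of_int j\<bar> \<le> 1 \<Longrightarrow> \<bar>u k j - h s\<bar> \<le> B * \<rho> ^ k"
    using geometric_limitE[OF u] by blast
  have "\<bar>u k \<lfloor>2 ^ k * t\<rfloor> - h t\<bar> \<le> B * \<rho> ^ k" for k
    by (rule B) (simp, linarith)
  then have "(\<lambda>k. u k \<lfloor>2 ^ k * t\<rfloor> - h t) \<longlonglongrightarrow> 0"
    by (intro Lim_null_comparison[OF _ geometric_error_tendsto_0[OF \<rho>, of B]]) auto
  then show ?thesis by (rule LIM_zero_cancel)
qed

text \<open>
  Two points at distance less than \<open>2\<^sup>-\<^sup>k / 2\<close> both have the index obtained by rounding \<open>2\<^sup>k t\<close> within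
  reach, so the two values of \<open>h\<close> are compared with the same datum.
\<close>

lemma geometric_limit_continuous:
  assumes \<rho>: "0 < \<rho>" "\<rho> < 1" and u: "geometric_limit \<rho> u h"
  shows "continuous_on UNIV h"
  unfolding continuous_on_iff
proof (intro ballI allI impI)
  fix t e :: real
  assume "0 < e"
  obtain B where B: "\<And>k j s. \<bar>s\<bar> \<le> \<bar>t\<bar> + 1 \<Longrightarrow> \<bar>2 ^ k * s - real_of_int j\<bar> \<le> 1 \<Longrightarrow> \<bar>u k j - h s\<bar> \<le> B * \<rho> ^ k"
    using geometric_limitE[OF u] by blast
  have "\<forall>\<^sub>F k in sequentially. 2 * B * \<rho> ^ k < e"
    using geometric_error_tendsto_0[OF \<rho>, of "2 * B"] \<open>0 < e\<close> by (rule order_tendstoD)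
  then obtain k where k: "2 * B * \<rho> ^ k < e" by (auto simp: eventually_sequentially)
  show "\<exists>d>0. \<forall>s\<in>UNIV. dist s t < d \<longrightarrow> dist (h s) (h t) < e"
  proof (intro exI[of _ "(1 / 2) / 2 ^ k"] conjI ballI impI)
    show "0 < (1 / 2 :: real) / 2 ^ k" by simp
    fix s
    assume "dist s t < (1 / 2) / 2 ^ k"
    then have st: "2 ^ k * \<bar>s - t\<bar> < 1 / 2" by (simp add: dist_real_def field_simps)
    have "\<bar>s - t\<bar> \<le> 2 ^ k * \<bar>s - t\<bar>" by (simp add: mult_le_cancel_right1)
    then have "\<bar>s\<bar> \<le> \<bar>t\<bar> + 1" using st by linarith
    moreover have "\<bar>2 ^ k * s - 2 ^ k * t\<bar> < 1 / 2"
      using st by (simp add: abs_mult flip: right_diff_distrib)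
    moreover have "\<bar>2 ^ k * t - real_of_int (round (2 ^ k * t))\<bar> \<le> 1 / 2"
      using of_int_round_abs_le[of "2 ^ k * t"] by linarith
    ultimately have "\<bar>u k (round (2 ^ k * t)) - h s\<bar> \<le> B * \<rho> ^ k"
      "\<bar>u k (round (2 ^ k * t)) - h t\<bar> \<le> B * \<rho> ^ k"
      by (auto simp only: intro!: B)
    then show "dist (h s) (h t) < e" using k by (simp add: dist_real_def)
  qed
qed

lemma abs_telescope_le:
  fixes x :: "int \<Rightarrow> real"
  assumes "n \<le> m" and "\<And>i. n \<le> i \<Longrightarrow> i < m \<Longrightarrow> \<bar>x (i + 1) - x i - p\<bar> \<le> q"
  shows "\<bar>x m - x n - real_of_int (m - n) * p\<bar> \<le> real_of_int (m - n) * q"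
  using assms
proof (induction m rule: int_ge_induct)
  case (step i)
  have "\<bar>x i - x n - real_of_int (i - n) * p\<bar> \<le> real_of_int (i - n) * q"
    using step by simp
  moreover have "\<bar>x (i + 1) - x i - p\<bar> \<le> q" using step by simp
  ultimately show ?case by (simp add: algebra_simps)
qed simp

lemma floor_dyadic_tendsto: "(\<lambda>k. real_of_int \<lfloor>2 ^ k * t\<rfloor> / 2 ^ k) \<longlonglongrightarrow> t" for t :: real
proof -
  have *: "\<bar>real_of_int \<lfloor>2 ^ k * t\<rfloor> / 2 ^ k - t\<bar> \<le> 1 * (1 / 2) ^ k" for k
  proof -
    have "real_of_int \<lfloor>2 ^ k * t\<rfloor> / 2 ^ k - t = (real_of_int \<lfloor>2 ^ k * t\<rfloor> - 2 ^ k * t) * (1 / 2) ^ k"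
      by (simp add: field_simps)
    also have "\<bar>\<dots>\<bar> \<le> 1 * (1 / 2) ^ k"
      unfolding abs_mult by (intro mult_mono) (simp_all, linarith)
    finally show ?thesis .
  qed
  have "(\<lambda>k. real_of_int \<lfloor>2 ^ k * t\<rfloor> / 2 ^ k - t) \<longlonglongrightarrow> 0"
    by (rule Lim_null_comparison[OF _ geometric_error_tendsto_0[of "1 / 2" 1]]) (use * in auto)
  then show ?thesis by (rule LIM_zero_cancel)
qed

text \<open>
  A difference of data over an index range is \<open>2\<^sup>-\<^sup>k\<close> times a sum of divided differences, all of
  which are close to values of \<open>h\<close> on \<open>[a, b]\<close>. In the limit this bounds
  \<open>g b - g a - h s (b - a)\<close> by the oscillation of \<open>h\<close>, a mean value inequality that replaces
  integrating \<open>h\<close>.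
\<close>

lemma geometric_limit_has_derivative:
  assumes \<rho>: "0 < \<rho>" "\<rho> < 1"
    and g: "geometric_limit \<rho> u g"
    and h: "geometric_limit \<rho> (\<lambda>k j. 2 ^ k * (u k (j + 1) - u k j)) h"
  shows "(g has_field_derivative h s) (at s)"
proof -
  have secant: "\<bar>g b - g a - h s * (b - a)\<bar> \<le> e * (b - a)"
    if "a < b" and e: "\<And>x. a \<le> x \<Longrightarrow> x \<le> b \<Longrightarrow> \<bar>h x - h s\<bar> \<le> e" for a b e
  proof -
    obtain B where B: "\<And>k j t. \<bar>t\<bar> \<le> \<bar>a\<bar> + \<bar>b\<bar> \<Longrightarrow> \<bar>2 ^ k * t - real_of_int j\<bar> \<le> 1 \<Longrightarrow>
        \<bar>2 ^ k * (u k (j + 1) - u k j) - h t\<bar> \<le> B * \<rho> ^ k"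
      using geometric_limitE[OF h] by blast
    define n where "n k = \<lfloor>2 ^ k * a\<rfloor>" for k :: nat
    define m where "m k = \<lfloor>2 ^ k * b\<rfloor>" for k :: nat
    have nm: "n k \<le> m k" for k
      unfolding n_def m_def using \<open>a < b\<close> by (intro floor_mono) simp
    have discrete: "\<bar>u k (m k) - u k (n k) - (real_of_int (m k) / 2 ^ k - real_of_int (n k) / 2 ^ k) * h s\<bar>
        \<le> (real_of_int (m k) / 2 ^ k - real_of_int (n k) / 2 ^ k) * (e + B * \<rho> ^ k)" for k
    proof -
      have step: "\<bar>u k (i + 1) - u k i - h s / 2 ^ k\<bar> \<le> (e + B * \<rho> ^ k) / 2 ^ k" if "n k \<le> i" "i < m k" for i
      proof -
        \<comment> \<open>The right end of the grid cell is used because its left end may lie to the left of \<open>a\<close>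
          when \<open>i = n k\<close>.\<close>
        define t where "t = real_of_int (i + 1) / 2 ^ k"
        have t: "2 ^ k * t = real_of_int i + 1" by (simp add: t_def)
        have "2 ^ k * a \<le> 2 ^ k * t" "2 ^ k * t \<le> 2 ^ k * b"
          using that unfolding t n_def m_def by linarith+
        then have "a \<le> t" "t \<le> b" by simp_all
        moreover from this have "\<bar>2 ^ k * (u k (i + 1) - u k i) - h t\<bar> \<le> B * \<rho> ^ k"
          using t by (intro B) auto
        ultimately have "\<bar>2 ^ k * (u k (i + 1) - u k i) - h s\<bar> \<le> e + B * \<rho> ^ k"
          using e[of t] by linarith
        moreover have "u k (i + 1) - u k i - h s / 2 ^ k = (2 ^ k * (u k (i + 1) - u k i) - h s) / 2 ^ k"
          by (simp add: field_simps)
        ultimately show ?thesis by (simp add: abs_divide divide_right_mono)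
      qed
      moreover have "real_of_int (m k) / 2 ^ k - real_of_int (n k) / 2 ^ k = real_of_int (m k - n k) / 2 ^ k"
        by (simp add: diff_divide_distrib)
      ultimately show ?thesis
        using abs_telescope_le[of "n k" "m k" "u k", OF nm step] by simp
    qed
    show ?thesis
    proof (rule LIMSEQ_le)
      show "(\<lambda>k. \<bar>u k (m k) - u k (n k) - (real_of_int (m k) / 2 ^ k - real_of_int (n k) / 2 ^ k) * h s\<bar>)
          \<longlonglongrightarrow> \<bar>g b - g a - h s * (b - a)\<bar>"
        unfolding n_def m_def mult.commute[of "h s"]
        by (intro tendsto_intros geometric_limit_floor[OF \<rho> g] floor_dyadic_tendsto)
      have "(\<lambda>k. (real_of_int (m k) / 2 ^ k - real_of_int (n k) / 2 ^ k) * (e + B * \<rho> ^ k))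
          \<longlonglongrightarrow> (b - a) * (e + 0)"
        unfolding n_def m_def
        by (intro tendsto_intros geometric_error_tendsto_0[OF \<rho>] floor_dyadic_tendsto)
      then show "(\<lambda>k. (real_of_int (m k) / 2 ^ k - real_of_int (n k) / 2 ^ k) * (e + B * \<rho> ^ k))
          \<longlonglongrightarrow> e * (b - a)"
        by (simp add: mult.commute)
    qed (use discrete in blast)
  qed
  show ?thesis
    unfolding has_field_derivative_def has_derivative_at_alt
  proof (intro conjI allI impI bounded_linear_mult_right)
    fix e :: real
    assume "0 < e"
    then obtain d where "0 < d" and d: "\<And>x. dist x s < d \<Longrightarrow> dist (h x) (h s) < e"
      using geometric_limit_continuous[OF \<rho> h] unfolding continuous_on_iff by blast
    have near: "\<bar>h x - h s\<bar> \<le> e" if "\<bar>x - s\<bar> < d" for x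
      using d[of x] that by (simp add: dist_real_def)
    show "\<exists>d>0. \<forall>t. norm (t - s) < d \<longrightarrow> norm (g t - g s - h s * (t - s)) \<le> e * norm (t - s)"
    proof (intro exI[of _ d] conjI allI impI)
      fix t
      assume "norm (t - s) < d"
      then have t: "\<bar>t - s\<bar> < d" by simp
      consider "t = s" | "s < t" | "t < s" by linarith
      then show "norm (g t - g s - h s * (t - s)) \<le> e * norm (t - s)"
      proof cases
        case 2
        then show ?thesis using secant[of s t e] near t by simp
      next
        case 3
        have "\<bar>g s - g t - h s * (s - t)\<bar> \<le> e * (s - t)"
          by (rule secant) (use 3 near t in auto)
        moreover have "g t - g s - h s * (t - s) = - (g s - g t - h s * (s - t))"
          by (simp add: algebra_simps)
        ultimately show ?thesis using 3 by (simp only: abs_minus_cancel real_norm_def) auto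
      qed simp
    qed (fact \<open>0 < d\<close>)
  qed
qed

section \<open>Limit functions\<close>

lemma ennreal_null_comparison:
  fixes f g :: "nat \<Rightarrow> ennreal"
  assumes "\<And>k. f k \<le> g k" "g \<longlonglongrightarrow> 0"
  shows "f \<longlonglongrightarrow> 0"
  by (rule tendsto_sandwich[OF _ _ tendsto_const assms(2)]) (simp_all add: assms(1))

lemma is_limit_function_if_geometric_limit:
  assumes \<rho>: "0 < \<rho>" "\<rho> < 1" and lim: "geometric_limit \<rho> (iterates S g0) g"
  shows "is_limit_function S g0 g"
  unfolding is_limit_function_def
proof (intro conjI allI impI)
  show "continuous_on UNIV g" by (rule geometric_limit_continuous[OF \<rho> lim])
  fix \<Omega> :: "real set"
  assume "compact \<Omega>"
  then obtain R where R: "\<And>x. x \<in> \<Omega> \<Longrightarrow> \<bar>x\<bar> \<le> R"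
    using compact_imp_bounded bounded_iff by (metis real_norm_def)
  obtain B where B: "\<And>k j t. \<bar>t\<bar> \<le> R + 1 \<Longrightarrow> \<bar>2 ^ k * t - real_of_int j\<bar> \<le> 1 \<Longrightarrow>
      \<bar>iterates S g0 k j - g t\<bar> \<le> B * \<rho> ^ k"
    using geometric_limitE[OF lim] by blast
  have "(SUP j \<in> {j. real_of_int j \<in> (\<lambda>x. 2 ^ k * x) ` \<Omega>}.
      ennreal \<bar>iterates S g0 k j - g (grid_point k j)\<bar>) \<le> ennreal (B * \<rho> ^ k)" for k
  proof (rule SUP_least, rule ennreal_leI, rule B)
    fix j
    assume "j \<in> {j. real_of_int j \<in> (\<lambda>x. 2 ^ k * x) ` \<Omega>}"
    then obtain x where x: "x \<in> \<Omega>" "real_of_int j = 2 ^ k * x" by auto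
    then have "grid_point k j = x - (1 / 2) / 2 ^ k"
      by (simp add: grid_point_def diff_divide_distrib)
    moreover have "0 \<le> (1 / 2 :: real) / 2 ^ k" by simp
    moreover have "(1 / 2 :: real) / 2 ^ k \<le> 1 / 1"
      by (rule frac_le) auto
    ultimately show "\<bar>grid_point k j\<bar> \<le> R + 1" using R[OF x(1)] by linarith
    show "\<bar>2 ^ k * grid_point k j - real_of_int j\<bar> \<le> 1" by (simp add: grid_point_def)
  qed
  moreover have "(\<lambda>k. ennreal (B * \<rho> ^ k)) \<longlonglongrightarrow> 0"
    using tendsto_ennrealI[OF geometric_error_tendsto_0[OF \<rho>, of B]] by simp
  ultimately show "(\<lambda>k. SUP j \<in> {j. real_of_int j \<in> (\<lambda>x. 2 ^ k * x) ` \<Omega>}.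
      ennreal \<bar>iterates S g0 k j - g (grid_point k j)\<bar>) \<longlonglongrightarrow> 0"
    by (rule ennreal_null_comparison)
qed

text \<open>
  This recovers the limit function pointwise from the iterates, which gives its uniqueness.
\<close>

lemma is_limit_function_floor:
  assumes "is_limit_function S g0 g"
  shows "(\<lambda>k. iterates S g0 k \<lfloor>2 ^ k * t\<rfloor>) \<longlonglongrightarrow> g t"
proof -
  let ?j = "\<lambda>k. \<lfloor>2 ^ k * t\<rfloor>"
  let ?E = "\<lambda>k. SUP j \<in> {j. real_of_int j \<in> (\<lambda>x. 2 ^ k * x) ` {t - 1..t}}.
      ennreal \<bar>iterates S g0 k j - g (grid_point k j)\<bar>"
  have "ennreal \<bar>iterates S g0 k (?j k) - g (grid_point k (?j k))\<bar> \<le> ?E k" for k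
  proof (rule SUP_upper)
    \<comment> \<open>The compact set is indexed by \<open>j / 2\<^sup>k\<close>, which lies at most \<open>2\<^sup>-\<^sup>k \<le> 1\<close> below \<open>t\<close>.\<close>
    have "1 \<le> (2 :: real) ^ k" by simp
    then have "2 ^ k * t - 2 ^ k \<le> real_of_int (?j k)" by linarith
    then have "t - 1 \<le> real_of_int (?j k) / 2 ^ k" by (simp add: field_simps)
    moreover have "real_of_int (?j k) / 2 ^ k \<le> t" by (simp add: field_simps)
    ultimately show "?j k \<in> {j. real_of_int j \<in> (\<lambda>x. 2 ^ k * x) ` {t - 1..t}}"
      by (intro CollectI image_eqI[of _ _ "real_of_int (?j k) / 2 ^ k"]) simp_all
  qed
  moreover have "?E \<longlonglongrightarrow> 0"
    by (rule assms[unfolded is_limit_function_def, THEN conjunct2, rule_format, OF compact_Icc])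
  ultimately have "(\<lambda>k. ennreal \<bar>iterates S g0 k (?j k) - g (grid_point k (?j k))\<bar>) \<longlonglongrightarrow> 0"
    by (rule ennreal_null_comparison)
  then have "(\<lambda>k. \<bar>iterates S g0 k (?j k) - g (grid_point k (?j k))\<bar>) \<longlonglongrightarrow> 0"
    by (subst (asm) ennreal_0[symmetric], subst (asm) tendsto_ennreal_iff) auto
  then have "(\<lambda>k. iterates S g0 k (?j k) - g (grid_point k (?j k))) \<longlonglongrightarrow> 0"
    by (simp add: tendsto_rabs_zero_iff)
  moreover have "(\<lambda>k. grid_point k (?j k)) \<longlonglongrightarrow> t - 0"
  proof -
    have "(\<lambda>k. real_of_int (?j k) / 2 ^ k - 1 / 2 * (1 / 2) ^ k) \<longlonglongrightarrow> t - 0"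
      by (intro tendsto_diff floor_dyadic_tendsto geometric_error_tendsto_0) auto
    then show ?thesis by (simp add: grid_point_def diff_divide_distrib power_one_over)
  qed
  moreover have "isCont g t"
    using assms unfolding is_limit_function_def by (simp add: continuous_on_eq_continuous_at)
  ultimately have "(\<lambda>k. iterates S g0 k (?j k) - g (grid_point k (?j k)) + g (grid_point k (?j k))) \<longlonglongrightarrow> 0 + g t"
    by (intro tendsto_add isCont_tendsto_compose[where g = g]) auto
  then show ?thesis by simp
qed

lemma is_limit_function_unique:
  assumes "is_limit_function S g0 g" "is_limit_function S g0 h"
  shows "g = h"
proof
  show "g t = h t" for t
    using is_limit_function_floor[OF assms(1)] is_limit_function_floor[OF assms(2)]
    by (rule LIMSEQ_unique)
qed

section \<open>Perturbed corner cutting\<close>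

lemma int_even_odd: obtains i :: int where "j = 2 * i" | i where "j = 2 * i + 1"
  by (metis evenE oddE)

locale perturbed_corner_cutting =
  fixes a :: "nat \<Rightarrow> int \<Rightarrow> int \<Rightarrow> real" and C :: real
  assumes support: "n \<notin> {-2, -1, 0, 1} \<Longrightarrow> a k j n = 0"
    and close: "\<bar>a k j n - cc_mask n\<bar> \<le> C / 4 ^ k"
begin

abbreviation S :: scheme where
  "S k \<equiv> subdiv (a k)"

lemma C_nonneg: "0 \<le> C"
  using close[of 0 0 0] by simp

lemma S_even: "S k g (2 * j) = a k j 0 * g j + a k j (-2) * g (j + 1)"
proof -
  have "S k g (2 * j + 0) = (\<Sum>i | a k j (2 * i + 0) \<noteq> 0. a k j (2 * i + 0) * g (j - i))"
    by (rule subdiv_rule) simp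
  also have "\<dots> = (\<Sum>i \<in> {0, -1}. a k j (2 * i + 0) * g (j - i))"
  proof (rule sum.mono_neutral_left)
    show "{i. a k j (2 * i + 0) \<noteq> 0} \<subseteq> {0, -1}"
    proof
      fix i
      assume "i \<in> {i. a k j (2 * i + 0) \<noteq> 0}"
      then have "2 * i \<in> {-2, -1, 0, 1}" using support[of "2 * i" k j] by fastforce
      then have "i = 0 \<or> i = -1" by simp presburger
      then show "i \<in> {0, -1}" by simp
    qed
  qed auto
  finally show ?thesis by simp
qed

lemma S_odd: "S k g (2 * j + 1) = a k j 1 * g j + a k j (-1) * g (j + 1)"
proof -
  have "S k g (2 * j + 1) = (\<Sum>i | a k j (2 * i + 1) \<noteq> 0. a k j (2 * i + 1) * g (j - i))"
    by (rule subdiv_rule) simp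
  also have "\<dots> = (\<Sum>i \<in> {0, -1}. a k j (2 * i + 1) * g (j - i))"
  proof (rule sum.mono_neutral_left)
    show "{i. a k j (2 * i + 1) \<noteq> 0} \<subseteq> {0, -1}"
    proof
      fix i
      assume "i \<in> {i. a k j (2 * i + 1) \<noteq> 0}"
      then have "2 * i + 1 \<in> {-2, -1, 0, 1}" using support[of "2 * i + 1" k j] by fastforce
      then have "i = 0 \<or> i = -1" by simp presburger
      then show "i \<in> {0, -1}" by simp
    qed
  qed auto
  finally show ?thesis by simp
qed

lemma S_near_corner_cutting:
  assumes "\<And>i. \<bar>g i\<bar> \<le> M"
  shows "\<bar>S k g (2 * j) - (3/4 * g j + 1/4 * g (j + 1))\<bar> \<le> 2 * C * M / 4 ^ k"
    and "\<bar>S k g (2 * j + 1) - (1/4 * g j + 3/4 * g (j + 1))\<bar> \<le> 2 * C * M / 4 ^ k"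
proof -
  have err: "\<bar>(a k j n - cc_mask n) * g i\<bar> \<le> C * M / 4 ^ k" for n i
    using mult_mono[OF close[of k j n] assms(1)[of i]] C_nonneg by (simp add: abs_mult)
  have "S k g (2 * j) - (3/4 * g j + 1/4 * g (j + 1))
      = (a k j 0 - cc_mask 0) * g j + (a k j (-2) - cc_mask (-2)) * g (j + 1)"
    unfolding S_even cc_mask_def by (simp add: field_simps)
  then show "\<bar>S k g (2 * j) - (3/4 * g j + 1/4 * g (j + 1))\<bar> \<le> 2 * C * M / 4 ^ k"
    using err[of 0 j] err[of "-2" "j + 1"] by (simp add: add_divide_distrib)
  have "S k g (2 * j + 1) - (1/4 * g j + 3/4 * g (j + 1))
      = (a k j 1 - cc_mask 1) * g j + (a k j (-1) - cc_mask (-1)) * g (j + 1)"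
    unfolding S_odd cc_mask_def by (simp add: field_simps)
  then show "\<bar>S k g (2 * j + 1) - (1/4 * g j + 3/4 * g (j + 1))\<bar> \<le> 2 * C * M / 4 ^ k"
    using err[of 1 j] err[of "-1" "j + 1"] by (simp add: add_divide_distrib)
qed

text \<open>
  The entries with indices \<open>2 i\<close> and \<open>2 i + 1\<close> are computed from those with indices \<open>i\<close> and \<open>i + 1\<close>.
  The window \<open>[-N 2\<^sup>k, N 2\<^sup>k + 2]\<close> is closed under passing to these two parents, since halving its
  right end at level \<open>k + 1\<close> gives \<open>N 2\<^sup>k + 1\<close> and the second parent adds \<open>1\<close>.
\<close>

lemma iterates_local:
  assumes "\<And>j. - N \<le> j \<Longrightarrow> j \<le> N + 2 \<Longrightarrow> f j = g j"
    and "- N * 2 ^ k \<le> j" "j \<le> N * 2 ^ k + 2"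
  shows "iterates S f k j = iterates S g k j"
  using assms(2,3)
proof (induction k arbitrary: j)
  case (Suc k)
  define i where "i = j div 2"
  have "j = 2 * i \<or> j = 2 * i + 1" unfolding i_def by presburger
  moreover have "- N * 2 ^ k \<le> i" "i + 1 \<le> N * 2 ^ k + 2"
    using Suc.prems unfolding i_def by simp_all
  then have "iterates S f k i = iterates S g k i" "iterates S f k (i + 1) = iterates S g k (i + 1)"
    by (auto intro!: Suc.IH)
  ultimately show ?case by (auto simp: S_even S_odd)
qed (simp add: assms(1))

text \<open>
  One step multiplies the supremum by at most \<open>1 + 2 C / 4\<^sup>k \<le> exp (3 C / 4\<^sup>k)\<close>, and the exponents
  add up to \<open>4 C (1 - 4\<^sup>-\<^sup>k)\<close>.
\<close>

lemma iterates_bounded: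
  assumes "\<And>j. \<bar>g0 j\<bar> \<le> M"
  shows "\<bar>iterates S g0 k j\<bar> \<le> M * exp (4 * C)"
proof -
  have M: "0 \<le> M" using assms[of 0] by linarith
  have "\<bar>iterates S g0 k j\<bar> \<le> M * exp (4 * C - 4 * C / 4 ^ k)" for k j
  proof (induction k arbitrary: j)
    case (Suc k)
    define K where "K = M * exp (4 * C - 4 * C / 4 ^ k)"
    let ?g = "iterates S g0 k"
    have g: "\<bar>?g i\<bar> \<le> K" for i using Suc K_def by simp
    note near = S_near_corner_cutting[of ?g K k, OF g]
    have "\<bar>S k ?g j\<bar> \<le> K + 2 * C * K / 4 ^ k"
    proof (cases j rule: int_even_odd)
      case (1 i)
      show ?thesis unfolding 1 using near(1)[of i] g[of i] g[of "i + 1"] by linarith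
    next
      case (2 i)
      show ?thesis unfolding 2 using near(2)[of i] g[of i] g[of "i + 1"] by linarith
    qed
    also have "\<dots> = K * (1 + 2 * C / 4 ^ k)" by (simp add: algebra_simps)
    also have "\<dots> \<le> K * exp (3 * C / 4 ^ k)"
    proof -
      have "1 + 2 * C / 4 ^ k \<le> 1 + 3 * C / 4 ^ k"
        using C_nonneg by (simp add: divide_right_mono)
      also have "\<dots> \<le> exp (3 * C / 4 ^ k)" by (rule exp_ge_add_one_self)
      finally show ?thesis using M by (intro mult_left_mono) (auto simp: K_def)
    qed
    also have "\<dots> = M * exp (4 * C - 4 * C / 4 ^ Suc k)"
      by (simp add: K_def exp_add[symmetric] field_simps)
    finally show ?case by simp
  qed (use assms in simp)
  also have "M * exp (4 * C - 4 * C / 4 ^ k) \<le> M * exp (4 * C)"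
    using M C_nonneg by (intro mult_left_mono) auto
  finally show ?thesis .
qed

definition slope :: "(int \<Rightarrow> real) \<Rightarrow> nat \<Rightarrow> int \<Rightarrow> real" where
  "slope g0 k j = 2 ^ k * (iterates S g0 k (j + 1) - iterates S g0 k j)"

text \<open>
  For exact corner cutting the divided differences obey these two rules without error. The factor
  \<open>2\<^sup>k\<^sup>+\<^sup>1\<close> in the divided difference turns the error \<open>O(4\<^sup>-\<^sup>k)\<close> of the data into \<open>O(2\<^sup>-\<^sup>k)\<close>.
\<close>

lemma slope_refinement:
  assumes "\<And>j. \<bar>g0 j\<bar> \<le> M"
  defines "Q \<equiv> 8 * C * (M * exp (4 * C))"
  shows "\<bar>slope g0 (Suc k) (2 * j) - slope g0 k j\<bar> \<le> Q / 2 ^ k"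
    and "\<bar>slope g0 (Suc k) (2 * j + 1) - (1/2 * slope g0 k j + 1/2 * slope g0 k (j + 1))\<bar> \<le> Q / 2 ^ k"
proof -
  let ?g = "iterates S g0 k"
  let ?E = "2 * C * (M * exp (4 * C)) / 4 ^ k"
  have Q: "2 ^ Suc k * (2 * ?E) = Q / 2 ^ k"
    using power_mult_distrib[of "2 :: real" 2 k] by (simp add: Q_def)
  note near = S_near_corner_cutting[of ?g "M * exp (4 * C)" k, OF iterates_bounded[of g0 M, OF assms(1)]]
  have scaled: "\<bar>2 ^ Suc k * (x - y)\<bar> \<le> Q / 2 ^ k" if "\<bar>x\<bar> \<le> ?E" "\<bar>y\<bar> \<le> ?E" for x y
  proof -
    have "\<bar>x - y\<bar> \<le> 2 * ?E" using that by linarith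
    then have "2 ^ Suc k * \<bar>x - y\<bar> \<le> 2 ^ Suc k * (2 * ?E)" by (rule mult_left_mono) simp
    then show ?thesis unfolding Q abs_mult by simp
  qed
  have "slope g0 (Suc k) (2 * j) - slope g0 k j = 2 ^ Suc k *
      ((S k ?g (2 * j + 1) - (1/4 * ?g j + 3/4 * ?g (j + 1))) - (S k ?g (2 * j) - (3/4 * ?g j + 1/4 * ?g (j + 1))))"
    by (simp add: slope_def field_simps)
  then show "\<bar>slope g0 (Suc k) (2 * j) - slope g0 k j\<bar> \<le> Q / 2 ^ k"
    by (simp only: scaled near)
  have j2: "2 * j + 1 + 1 = 2 * (j + 1)" by simp
  have "slope g0 (Suc k) (2 * j + 1) - (1/2 * slope g0 k j + 1/2 * slope g0 k (j + 1)) = 2 ^ Suc k *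
      ((S k ?g (2 * (j + 1)) - (3/4 * ?g (j + 1) + 1/4 * ?g (j + 1 + 1)))
       - (S k ?g (2 * j + 1) - (1/4 * ?g j + 3/4 * ?g (j + 1))))"
    unfolding slope_def iterates.simps j2 by (simp add: field_simps)
  then show "\<bar>slope g0 (Suc k) (2 * j + 1) - (1/2 * slope g0 k j + 1/2 * slope g0 k (j + 1))\<bar> \<le> Q / 2 ^ k"
    by (simp only: scaled near)
qed

text \<open>
  Refinement by averaging keeps divided differences bounded up to the summable error. It halves
  their neighbour differences up to an error \<open>2 Q / 2\<^sup>k\<close>. Since error and contraction both have rate
  \<open>1/2\<close>, the resulting bound would be of order \<open>k / 2\<^sup>k\<close>; the rate \<open>3/4\<close> absorbs the factor \<open>k\<close>.
\<close>

lemma slope_geometric: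
  assumes "\<And>j. \<bar>g0 j\<bar> \<le> M"
  shows "\<exists>B. \<forall>k j. \<bar>slope g0 k j\<bar> \<le> B \<and>
      \<bar>slope g0 k (j + 1) - slope g0 k j\<bar> \<le> B * (3/4) ^ k \<and>
      \<bar>slope g0 (Suc k) (2 * j) - slope g0 k j\<bar> \<le> B * (3/4) ^ k \<and>
      \<bar>slope g0 (Suc k) (2 * j + 1) - slope g0 k j\<bar> \<le> B * (3/4) ^ k"
proof -
  define Q where "Q = 8 * C * (M * exp (4 * C))"
  have M: "0 \<le> M" using assms[of 0] by linarith
  have Q: "0 \<le> Q" using M C_nonneg by (simp add: Q_def)
  note refine = slope_refinement[of g0 M, OF assms, folded Q_def]
  define D where "D = 2 * M + 2 * Q"
  have bound: "\<bar>slope g0 k j\<bar> \<le> D - 2 * Q / 2 ^ k" for k j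
  proof (induction k arbitrary: j)
    case 0
    show ?case using assms[of j] assms[of "j + 1"] by (simp add: slope_def D_def)
  next
    case (Suc k)
    have bound_Suc: "D - 2 * Q / 2 ^ Suc k = D - 2 * Q / 2 ^ k + Q / 2 ^ k" by (simp add: field_simps)
    show ?case
    proof (cases j rule: int_even_odd)
      case (1 i)
      show ?thesis
        unfolding bound_Suc 1 using Suc[of i] refine(1)[where k=k and j=i] by linarith
    next
      case (2 i)
      show ?thesis
        unfolding bound_Suc 2 using Suc[of i] Suc[of "i + 1"] refine(2)[where k=k and j=i] by linarith
    qed
  qed
  have bounded: "\<bar>slope g0 k j\<bar> \<le> D" for k j
    proof -
    have "0 \<le> 2 * Q / 2 ^ k" using Q by simp
    then show ?thesis using bound[of k j] by linarith
  qed
  \<comment> \<open>\<open>2 D\<close> starts the induction, and \<open>Z \<ge> 8 Q\<close> is what \<open>Z / 2 + 2 Q \<le> 3/4 Z\<close> requires.\<close>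
  define Z where "Z = 2 * D + 8 * Q"
  have geo: "Q / 2 ^ k \<le> Q * (3/4) ^ k" for k
    using mult_left_mono[OF power_mono[of "1/2" "3/4 :: real" k] Q] by (simp add: power_one_over)
  have diff: "\<bar>slope g0 k (j + 1) - slope g0 k j\<bar> \<le> Z * (3/4) ^ k" for k j
  proof (induction k arbitrary: j)
    case 0
    show ?case using bounded[of 0 j] bounded[of 0 "j + 1"] Q by (simp add: Z_def)
  next
    case (Suc k)
    have half: "\<bar>slope g0 (Suc k) (j + 1) - slope g0 (Suc k) j\<bar> \<le> Z * (3/4) ^ k / 2 + 2 * (Q / 2 ^ k)"
    proof (cases j rule: int_even_odd)
      case (1 i)
      show ?thesis unfolding 1 using refine[where k=k and j=i] Suc[of i] by linarith
    next
      case (2 i)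
      then have j1: "j + 1 = 2 * (i + 1)" by simp
      show ?thesis unfolding j1 unfolding 2
        using refine(1)[where k=k and j="i + 1"] refine(2)[where k=k and j=i] Suc[of i] by linarith
    qed
    also have "\<dots> \<le> Z * (3/4) ^ k / 2 + 2 * (Q * (3/4) ^ k)" using geo[of k] by linarith
    also have "\<dots> = (Z / 2 + 2 * Q) * (3/4) ^ k" by (simp add: algebra_simps)
    also have "\<dots> \<le> (Z * (3/4)) * (3/4) ^ k"
      using Q M by (intro mult_right_mono) (auto simp: Z_def D_def)
    finally show ?case by simp
  qed
  define B where "B = D + Z + Q"
  have "D \<le> B" using Q M by (simp add: B_def Z_def D_def)
  moreover have "Z * (3/4) ^ k \<le> B * (3/4) ^ k" for k
    using Q M by (intro mult_right_mono) (auto simp: B_def D_def)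
  moreover have "\<bar>slope g0 (Suc k) (2 * j) - slope g0 k j\<bar> \<le> B * (3/4) ^ k" for k j
  proof -
    have "Q * (3/4) ^ k \<le> B * (3/4) ^ k"
      using Q M by (intro mult_right_mono) (auto simp: B_def D_def Z_def)
    then show ?thesis using refine(1)[where k=k and j=j] geo[of k] by linarith
  qed
  moreover have "\<bar>slope g0 (Suc k) (2 * j + 1) - slope g0 k j\<bar> \<le> B * (3/4) ^ k" for k j
  proof -
    have "(Z + Q) * (3/4) ^ k \<le> B * (3/4) ^ k"
      using Q M by (intro mult_right_mono) (auto simp: B_def D_def Z_def)
    then have "Z * (3/4) ^ k + Q * (3/4) ^ k \<le> B * (3/4) ^ k" by (simp add: algebra_simps)
    moreover have "0 \<le> Z * (3/4) ^ k" using diff[of k j] by linarith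
    ultimately show ?thesis using refine(2)[where k=k and j=j] geo[of k] diff[of k j] by linarith
  qed
  ultimately show ?thesis using bounded diff by (meson order_trans)
qed

lemma iterates_geometric:
  assumes "\<And>j. \<bar>g0 j\<bar> \<le> M"
  shows "\<exists>B. \<forall>k j. \<bar>iterates S g0 k (j + 1) - iterates S g0 k j\<bar> \<le> B * (3/4) ^ k \<and>
      \<bar>iterates S g0 (Suc k) (2 * j) - iterates S g0 k j\<bar> \<le> B * (3/4) ^ k \<and>
      \<bar>iterates S g0 (Suc k) (2 * j + 1) - iterates S g0 k j\<bar> \<le> B * (3/4) ^ k"
proof -
  obtain D where D: "\<And>k j. \<bar>slope g0 k j\<bar> \<le> D" using slope_geometric[of g0 M, OF assms] by blast
  have D0: "0 \<le> D" using D[of 0 0] by linarith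
  define P where "P = 2 * C * (M * exp (4 * C))"
  have "0 \<le> M" using assms[of 0] by linarith
  then have P: "0 \<le> P" using C_nonneg by (simp add: P_def)
  have diff: "\<bar>iterates S g0 k (j + 1) - iterates S g0 k j\<bar> \<le> D * (3/4) ^ k" for k j
  proof -
    have "iterates S g0 k (j + 1) - iterates S g0 k j = slope g0 k j * (1/2) ^ k"
      by (simp add: slope_def power_one_over)
    also have "\<bar>\<dots>\<bar> \<le> D * (3/4) ^ k"
      unfolding abs_mult using D[of k j] D0 by (intro mult_mono) (auto intro: power_mono)
    finally show ?thesis .
  qed
  have geo: "P / 4 ^ k \<le> P * (3/4) ^ k" for k
    using mult_left_mono[OF power_mono[of "1/4" "3/4 :: real" k] P]
    by (simp add: power_one_over)
  note near = S_near_corner_cutting[of "iterates S g0 k" "M * exp (4 * C)" k for k,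
      OF iterates_bounded[of g0 M, OF assms], folded P_def]
  have "\<bar>iterates S g0 k (j + 1) - iterates S g0 k j\<bar> \<le> (D + P) * (3/4) ^ k \<and>
      \<bar>iterates S g0 (Suc k) (2 * j) - iterates S g0 k j\<bar> \<le> (D + P) * (3/4) ^ k \<and>
      \<bar>iterates S g0 (Suc k) (2 * j + 1) - iterates S g0 k j\<bar> \<le> (D + P) * (3/4) ^ k" for k j
  proof -
    have "0 \<le> P * (3/4) ^ k" "0 \<le> D * (3/4) ^ k" using P D0 by simp_all
    then show ?thesis
      unfolding iterates.simps distrib_right
      using near[of k j] diff[of k j] geo[of k] by (intro conjI) linarith+
  qed
  then show ?thesis by blast
qed

lemma truncation:
  fixes N :: int and g0 :: "int \<Rightarrow> real"
  shows "\<exists>f M. (\<forall>j. - N \<le> j \<longrightarrow> j \<le> N + 2 \<longrightarrow> g0 j = f j) \<and> (\<forall>j. \<bar>f j\<bar> \<le> M)"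
proof (intro exI conjI allI impI)
  define f where "f j = (if j \<in> {- N..N + 2} then g0 j else 0)" for j
  show "g0 j = f j" if "- N \<le> j" "j \<le> N + 2" for j using that by (simp add: f_def)
  show "\<bar>f j\<bar> \<le> (\<Sum>i \<in> {- N..N + 2}. \<bar>g0 i\<bar>)" for j
    using member_le_sum[of j "{- N..N + 2}" "\<lambda>i. \<bar>g0 i\<bar>"] by (auto simp: f_def sum_nonneg)
qed

lemma C1_limit:
  obtains g where "geometric_limit (3/4) (iterates S g0) g" "g C1_differentiable_on UNIV"
proof -
  have "\<exists>g. geometric_limit (3/4) (iterates S g0) g"
  proof (rule geometric_limit_exists)
    fix N :: int
    assume "0 \<le> N"
    obtain f M where "\<forall>j. - N \<le> j \<longrightarrow> j \<le> N + 2 \<longrightarrow> g0 j = f j" "\<forall>j. \<bar>f j\<bar> \<le> M"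
      using truncation[of N g0] by blast
    note f = this[rule_format]
    obtain B where B: "\<forall>k j. \<bar>iterates S f k (j + 1) - iterates S f k j\<bar> \<le> B * (3/4) ^ k \<and>
      \<bar>iterates S f (Suc k) (2 * j) - iterates S f k j\<bar> \<le> B * (3/4) ^ k \<and>
      \<bar>iterates S f (Suc k) (2 * j + 1) - iterates S f k j\<bar> \<le> B * (3/4) ^ k"
      using iterates_geometric[of f M, OF f(2)] by blast
    have same: "iterates S g0 k i = iterates S f k i" if "- N * 2 ^ k \<le> i" "i \<le> N * 2 ^ k + 2" for k i
      using iterates_local[of N g0 f, OF f(1) that] by blast
    show "\<exists>B. \<forall>k j. - N * 2 ^ k \<le> j \<longrightarrow> j \<le> N * 2 ^ k \<longrightarrow>
          \<bar>iterates S g0 (Suc k) (2 * j) - iterates S g0 k j\<bar> \<le> B * (3/4) ^ k \<and>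
          \<bar>iterates S g0 (Suc k) (2 * j + 1) - iterates S g0 k j\<bar> \<le> B * (3/4) ^ k \<and>
          \<bar>iterates S g0 k (j + 1) - iterates S g0 k j\<bar> \<le> B * (3/4) ^ k"
    proof (intro exI[of _ B] allI impI)
      fix k j
      assume j: "- N * 2 ^ k \<le> j" "j \<le> N * 2 ^ k"
      have double: "- N * 2 ^ Suc k = 2 * (- N * 2 ^ k)" "N * 2 ^ Suc k = 2 * (N * 2 ^ k)" by simp_all
      have j2: "- N * 2 ^ Suc k \<le> 2 * j" "2 * j \<le> N * 2 ^ Suc k"
        unfolding double using j by linarith+
      have same_data:
        "iterates S g0 k j = iterates S f k j"
        "iterates S g0 k (j + 1) = iterates S f k (j + 1)"
        "iterates S g0 (Suc k) (2 * j) = iterates S f (Suc k) (2 * j)"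
        "iterates S g0 (Suc k) (2 * j + 1) = iterates S f (Suc k) (2 * j + 1)"
        by (rule same; use j j2 in linarith)+
      show "\<bar>iterates S g0 (Suc k) (2 * j) - iterates S g0 k j\<bar> \<le> B * (3/4) ^ k \<and>
          \<bar>iterates S g0 (Suc k) (2 * j + 1) - iterates S g0 k j\<bar> \<le> B * (3/4) ^ k \<and>
          \<bar>iterates S g0 k (j + 1) - iterates S g0 k j\<bar> \<le> B * (3/4) ^ k"
        unfolding same_data using B[rule_format, of k j] by blast
    qed
  qed auto
  then obtain g where g: "geometric_limit (3/4) (iterates S g0) g" by blast
  have "\<exists>h. geometric_limit (3/4) (slope g0) h"
  proof (rule geometric_limit_exists)
    fix N :: int
    assume "0 \<le> N"
    obtain f M where "\<forall>j. - N \<le> j \<longrightarrow> j \<le> N + 2 \<longrightarrow> g0 j = f j" "\<forall>j. \<bar>f j\<bar> \<le> M"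
      using truncation[of N g0] by blast
    note f = this[rule_format]
    obtain B where B: "\<forall>k j. \<bar>slope f k j\<bar> \<le> B \<and>
      \<bar>slope f k (j + 1) - slope f k j\<bar> \<le> B * (3/4) ^ k \<and>
      \<bar>slope f (Suc k) (2 * j) - slope f k j\<bar> \<le> B * (3/4) ^ k \<and>
      \<bar>slope f (Suc k) (2 * j + 1) - slope f k j\<bar> \<le> B * (3/4) ^ k"
      using slope_geometric[of f M, OF f(2)] by blast
    have same: "slope g0 k i = slope f k i" if "- N * 2 ^ k \<le> i" "i \<le> N * 2 ^ k + 1" for k i
      using that iterates_local[of N g0 f k i, OF f(1)] iterates_local[of N g0 f k "i + 1", OF f(1)]
      by (simp add: slope_def)
    show "\<exists>B. \<forall>k j. - N * 2 ^ k \<le> j \<longrightarrow> j \<le> N * 2 ^ k \<longrightarrow>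
          \<bar>slope g0 (Suc k) (2 * j) - slope g0 k j\<bar> \<le> B * (3/4) ^ k \<and>
          \<bar>slope g0 (Suc k) (2 * j + 1) - slope g0 k j\<bar> \<le> B * (3/4) ^ k \<and>
          \<bar>slope g0 k (j + 1) - slope g0 k j\<bar> \<le> B * (3/4) ^ k"
    proof (intro exI[of _ B] allI impI)
      fix k j
      assume j: "- N * 2 ^ k \<le> j" "j \<le> N * 2 ^ k"
      have double: "- N * 2 ^ Suc k = 2 * (- N * 2 ^ k)" "N * 2 ^ Suc k = 2 * (N * 2 ^ k)" by simp_all
      have j2: "- N * 2 ^ Suc k \<le> 2 * j" "2 * j \<le> N * 2 ^ Suc k"
        unfolding double using j by linarith+
      have same_data:
        "slope g0 k j = slope f k j"
        "slope g0 k (j + 1) = slope f k (j + 1)"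
        "slope g0 (Suc k) (2 * j) = slope f (Suc k) (2 * j)"
        "slope g0 (Suc k) (2 * j + 1) = slope f (Suc k) (2 * j + 1)"
        by (rule same; use j j2 in linarith)+
      show "\<bar>slope g0 (Suc k) (2 * j) - slope g0 k j\<bar> \<le> B * (3/4) ^ k \<and>
          \<bar>slope g0 (Suc k) (2 * j + 1) - slope g0 k j\<bar> \<le> B * (3/4) ^ k \<and>
          \<bar>slope g0 k (j + 1) - slope g0 k j\<bar> \<le> B * (3/4) ^ k"
        unfolding same_data using B[rule_format, of k j] by blast
    qed
  qed auto
  then obtain h where h: "geometric_limit (3/4) (\<lambda>k j. 2 ^ k * (iterates S g0 k (j + 1) - iterates S g0 k j)) h"
    unfolding slope_def[abs_def] by blast
  have "(g has_vector_derivative h x) (at x)" for x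
    using geometric_limit_has_derivative[OF _ _ g h, of x]
    by (simp add: has_real_derivative_iff_has_vector_derivative)
  moreover have "continuous_on UNIV h"
    by (rule geometric_limit_continuous[OF _ _ h]) auto
  ultimately have "g C1_differentiable_on UNIV"
    unfolding C1_differentiable_on_def by blast
  with g show thesis using that by blast
qed

text \<open>
  All entries are positive and those of index \<open>0\<close> and \<open>-1\<close> exceed \<open>1/2\<close>, so the minimum of the
  data drops at most by half per level. From a level \<open>K\<close> on, the row sums are so close to \<open>1\<close> that
  the lower bound \<open>L (1 + 2\<^sup>-\<^sup>k)\<close> reproduces itself, and it never falls below \<open>L\<close>.
\<close>

lemma limit_of_one_positive:
  assumes lower: "\<And>k j n. n \<in> {-2, -1, 0, 1} \<Longrightarrow> cc_mask n - 1/4 < a k j n"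
    and g: "geometric_limit (3/4) (iterates S (\<lambda>_. 1)) g"
  shows "0 < g t"
proof -
  let ?g = "iterates S (\<lambda>_. 1)"
  have pos: "0 < a k j (-2)" "0 < a k j 1" "1/2 < a k j 0" "1/2 < a k j (-1)" for k j
    using lower[of "-2" k j] lower[of 1 k j] lower[of 0 k j] lower[of "-1" k j]
    by (simp_all add: cc_mask_def)
  have refine: "w * x \<le> S k f j"
    if f: "\<And>i. x \<le> f i" and "0 \<le> x" and w: "\<And>i. w \<le> a k i 0 + a k i (-2)" "\<And>i. w \<le> a k i 1 + a k i (-1)"
    for w x k f j
  proof (cases j rule: int_even_odd)
    case (1 i)
    have "w * x \<le> a k i 0 * x + a k i (-2) * x"
      using mult_right_mono[OF w(1)[of i] \<open>0 \<le> x\<close>] by (simp add: algebra_simps)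
    also have "\<dots> \<le> S k f j"
      unfolding 1 S_even using pos[of k i] f by (intro add_mono mult_left_mono) auto
    finally show ?thesis .
  next
    case (2 i)
    have "w * x \<le> a k i 1 * x + a k i (-1) * x"
      using mult_right_mono[OF w(2)[of i] \<open>0 \<le> x\<close>] by (simp add: algebra_simps)
    also have "\<dots> \<le> S k f j"
      unfolding 2 S_odd using pos[of k i] f by (intro add_mono mult_left_mono) auto
    finally show ?thesis .
  qed
  have crude: "(1/2) ^ k \<le> ?g k j" for k j
  proof (induction k arbitrary: j)
    case (Suc k)
    have "1/2 * (1/2) ^ k \<le> S k (?g k) j"
    proof (rule refine)
      show "1/2 \<le> a k i 0 + a k i (-2)" "1/2 \<le> a k i 1 + a k i (-1)" for i
        using pos[of k i] by linarith+
    qed (use Suc in auto)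
    then show ?case by simp
  qed simp
  \<comment> \<open>From level \<open>K\<close> on, the row sum error \<open>2 C / 4\<^sup>k\<close> is at most an eighth of \<open>2\<^sup>-\<^sup>k\<close>.\<close>
  obtain K where K: "16 * C < 2 ^ K"
    using real_arch_pow[of 2 "16 * C"] by auto
  define L :: real where "L = (1/2) ^ K / 2"
  have L: "0 < L" by (simp add: L_def)
  have fine: "L * (1 + (1/2) ^ (K + n)) \<le> ?g (K + n) j" for n j
  proof (induction n arbitrary: j)
    case 0
    have "L * (1 + (1/2) ^ K) \<le> L * 2"
      using L by (intro mult_left_mono) (auto simp: power_le_one)
    also have "L * 2 = (1/2) ^ K" by (simp add: L_def)
    finally show ?case using crude[of K j] by simp
  next
    case (Suc n)
    define k where "k = K + n"
    define x where "x = (1/2 :: real) ^ k"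
    have x: "0 < x" "x \<le> 1" by (auto simp: x_def power_le_one)
    have rows: "2 * (C / 4 ^ k) \<le> x / 8"
    proof -
      have "16 * C \<le> 2 ^ k"
        using K power_increasing[of K k "2 :: real"] unfolding k_def by linarith
      then have "16 * C * (x * x) \<le> 2 ^ k * (x * x)" using x by (intro mult_right_mono) auto
      also have "\<dots> = x" by (simp add: x_def power_one_over)
      also have "x * x = 1 / 4 ^ k"
        by (simp add: x_def power_one_over power_mult_distrib[symmetric])
      finally show ?thesis by simp
    qed
    have "(1 - x / 8) * (L * (1 + x)) \<le> S k (?g k) j"
    proof (rule refine)
      show "L * (1 + x) \<le> ?g k i" for i using Suc[of i] by (simp add: k_def x_def)
      show "0 \<le> L * (1 + x)" using L x by simp
      show "1 - x / 8 \<le> a k i 0 + a k i (-2)" for i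
        using close[of k i 0] close[of k i "-2"] rows by (simp add: cc_mask_def abs_le_iff)
      show "1 - x / 8 \<le> a k i 1 + a k i (-1)" for i
        using close[of k i 1] close[of k i "-1"] rows by (simp add: cc_mask_def abs_le_iff)
    qed
    moreover have "L * (1 + x / 2) \<le> (1 - x / 8) * (L * (1 + x))"
    proof -
      have "x * x \<le> x" using x by (simp add: mult_le_cancel_left1)
      moreover have "(1 - x / 8) * (1 + x) = 1 + 7/8 * x - 1/8 * (x * x)" by (simp add: field_simps)
      ultimately have "1 + x / 2 \<le> (1 - x / 8) * (1 + x)" using x by linarith
      from mult_left_mono[OF this, of L] L show ?thesis by (simp add: algebra_simps)
    qed
    ultimately show ?case by (simp add: k_def x_def)
  qed
  have "(\<lambda>k. ?g k \<lfloor>2 ^ k * t\<rfloor>) \<longlonglongrightarrow> g t"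
    by (rule geometric_limit_floor[OF _ _ g]) auto
  moreover have "L \<le> ?g k \<lfloor>2 ^ k * t\<rfloor>" if "K \<le> k" for k
  proof -
    have "L * 1 \<le> L * (1 + (1/2) ^ k)" using L by (intro mult_left_mono) auto
    also have "\<dots> \<le> ?g k \<lfloor>2 ^ k * t\<rfloor>"
      using fine[of "k - K"] that by simp
    finally show ?thesis by simp
  qed
  ultimately have "L \<le> g t" by (intro LIMSEQ_le_const) auto
  then show ?thesis using L by simp
qed

lemma C1_scheme_if_mask_positive:
  assumes "\<And>k j n. n \<in> {-2, -1, 0, 1} \<Longrightarrow> cc_mask n - 1/4 < a k j n"
  shows "C1_scheme S"
proof -
  have lim: "\<exists>g. is_limit_function S g0 g \<and> g C1_differentiable_on UNIV" for g0
  proof -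
    obtain g where g: "geometric_limit (3/4) (iterates S g0) g" "g C1_differentiable_on UNIV"
      by (rule C1_limit)
    then show ?thesis using is_limit_function_if_geometric_limit[OF _ _ g(1)] by auto
  qed
  obtain g where g: "geometric_limit (3/4) (iterates S (\<lambda>_. 1)) g" by (rule C1_limit)
  then have "is_limit_function S (\<lambda>_. 1) g"
    by (intro is_limit_function_if_geometric_limit[of "3/4"]) auto
  moreover have "g \<noteq> (\<lambda>x. 0)"
    using limit_of_one_positive[OF assms g, of 0] by auto
  ultimately have "convergent_scheme S"
    unfolding convergent_scheme_def using lim by blast
  moreover have "g C1_differentiable_on UNIV" if "is_limit_function S g0 g" for g0 g
    using lim[of g0] is_limit_function_unique[OF that] by blast
  ultimately show ?thesis unfolding C1_scheme_def by blast
qed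

end

section \<open>Size of the mask perturbation\<close>

text \<open>
  The even terms of the Taylor expansion of the exponential cancel in \<open>sinh\<close>, so second-order
  expansions at \<open>z\<close> and \<open>-z\<close> leave a cubic error.
\<close>

lemma norm_sinh_minus_self_le:
  fixes z :: complex
  assumes "norm z \<le> 1"
  shows "norm (sinh z - z) \<le> 2 * norm z ^ 3"
proof -
  have taylor: "norm (exp w - (1 + w + w\<^sup>2 / 2)) \<le> 2 * norm z ^ 3" if "norm w = norm z" for w :: complex
  proof -
    have "norm (exp w - (\<Sum>i\<le>2. w ^ i / fact i)) \<le> exp \<bar>Re w\<bar> * norm w ^ Suc 2 / fact 2"
      by (rule Taylor_exp)
    also have "(\<Sum>i\<le>2. w ^ i / fact i) = 1 + w + w\<^sup>2 / 2"
      by (simp add: numeral_2_eq_2)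
    also have "exp \<bar>Re w\<bar> * norm w ^ Suc 2 / fact 2 \<le> 4 * norm w ^ Suc 2 / fact 2"
    proof (intro divide_right_mono mult_right_mono)
      have "\<bar>Re w\<bar> \<le> 1" using abs_Re_le_cmod[of w] that assms by linarith
      then have "exp \<bar>Re w\<bar> \<le> exp 1" by simp
      then show "exp \<bar>Re w\<bar> \<le> 4" using exp_le by linarith
    qed auto
    finally show ?thesis using that by (simp add: numeral_3_eq_3 numeral_2_eq_2)
  qed
  have "sinh z - z = ((exp z - (1 + z + z\<^sup>2 / 2)) - (exp (- z) - (1 + (- z) + (- z)\<^sup>2 / 2))) / 2"
    by (simp add: sinh_field_def field_simps)
  also have "norm \<dots> \<le> (2 * norm z ^ 3 + 2 * norm z ^ 3) / 2"
    unfolding norm_divide norm_numeral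
    by (intro divide_right_mono order_trans[OF norm_triangle_ineq4] add_mono taylor) auto
  finally show ?thesis by simp
qed

lemma sinh_quot_near:
  assumes r: "0 \<le> r" "r \<le> 1" and z: "norm z \<le> 1/2"
  shows "\<bar>sinh_quot r z - r\<bar> \<le> 8 * (norm z)\<^sup>2"
proof (cases "z = 0")
  case False
  let ?z = "of_real r * z"
  define x where "x = norm z"
  have x: "0 < x" "x \<le> 1/2" using False z by (auto simp: x_def)
  have rx: "norm ?z \<le> x" using r by (simp add: norm_mult x_def mult_left_le_one_le)
  have num: "norm (sinh ?z - ?z) \<le> 2 * x ^ 3"
  proof -
    have "norm (sinh ?z - ?z) \<le> 2 * norm ?z ^ 3" using rx x by (intro norm_sinh_minus_self_le) linarith
    moreover have "norm ?z ^ 3 \<le> x ^ 3" using rx by (intro power_mono) auto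
    ultimately show ?thesis by linarith
  qed
  have den: "norm (sinh z - z) \<le> 2 * x ^ 3"
    using norm_sinh_minus_self_le[of z] x by (simp add: x_def)
  have "2 * x ^ 3 \<le> x / 2"
  proof -
    have "x * x \<le> 1/2 * (1/2)" using x by (intro mult_mono) auto
    then have "x * (x * x) \<le> x * (1/4)" using x by (intro mult_left_mono) auto
    then show ?thesis by (simp add: power3_eq_cube)
  qed
  then have low: "x / 2 \<le> norm (sinh z)"
    using den norm_triangle_ineq2[of z "z - sinh z"] by (simp add: x_def norm_minus_commute)
  then have "sinh z \<noteq> 0" using x by auto
  have "sinh_quot r z - r = Re (sinh ?z / sinh z - of_real r)"
    using False by (simp add: sinh_quot_def)
  also have "\<bar>\<dots>\<bar> \<le> norm (sinh ?z / sinh z - of_real r)" by (rule abs_Re_le_cmod)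
  also have "sinh ?z / sinh z - of_real r = ((sinh ?z - ?z) - of_real r * (sinh z - z)) / sinh z"
    using \<open>sinh z \<noteq> 0\<close> by (simp add: field_simps)
  also have "norm \<dots> \<le> (2 * x ^ 3 + 2 * x ^ 3) / (x / 2)"
  proof -
    have "norm (of_real r * (sinh z - z)) \<le> norm (sinh z - z)"
      using r by (simp add: norm_mult mult_left_le_one_le)
    then have "norm ((sinh ?z - ?z) - of_real r * (sinh z - z)) \<le> 2 * x ^ 3 + 2 * x ^ 3"
      using norm_triangle_ineq4[of "sinh ?z - ?z" "of_real r * (sinh z - z)"] num den by linarith
    then show ?thesis
      unfolding norm_divide using low x by (intro frac_le) auto
  qed
  also have "\<dots> = 8 * x\<^sup>2" using x by (simp add: power3_eq_cube power2_eq_square)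
  finally show ?thesis by (simp add: x_def)
qed (simp add: sinh_quot_def)

text \<open>
  The quadratic estimate for the quotient of \<open>sinh\<close> needs a small argument \<open>z\<close>. For
  \<open>\<bar>z\<bar> > 1/2\<close>, which can happen at the first levels, the a priori distance \<open>1/4\<close> is itself
  below \<open>\<bar>z\<bar>\<^sup>2\<close>, so a single constant serves all levels.
\<close>

lemma shape_mask_near:
  assumes B: "\<And>n. norm (\<gamma> n) \<le> B"
    and bounds: "\<And>n. n \<in> {-2, -1, 0, 1} \<Longrightarrow> \<bar>shape_mask k \<gamma> j n - cc_mask n\<bar> \<le> 1/4"
  shows "\<bar>shape_mask k \<gamma> j n - cc_mask n\<bar> \<le> 8 * B\<^sup>2 / 4 ^ k"
proof (cases "n \<in> {-2, -1, 0, 1}")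
  case True
  define r where "r = cc_mask n"
  have r: "0 \<le> r" "r \<le> 1" "cc_mask n = r" by (auto simp: r_def cc_mask_def)
  obtain i where i: "shape_mask k \<gamma> j n = sinh_quot r (\<gamma> i / 2 ^ k)"
    using True unfolding r_def cc_mask_def shape_mask_def by auto
  define z where "z = \<gamma> i / 2 ^ k"
  have "\<bar>shape_mask k \<gamma> j n - cc_mask n\<bar> \<le> 8 * (norm z)\<^sup>2"
  proof (cases "norm z \<le> 1/2")
    case True
    then show ?thesis using sinh_quot_near[OF r(1,2)] r(3) i by (simp add: z_def)
  next
    case False
    then have "(1/2)\<^sup>2 \<le> (norm z)\<^sup>2" by (intro power_mono) auto
    then show ?thesis using bounds[OF True] by (simp add: power2_eq_square)
  qed
  also have "(norm z)\<^sup>2 = (norm (\<gamma> i))\<^sup>2 / 4 ^ k"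
    by (simp add: z_def norm_divide norm_power power_divide power_mult[symmetric] mult.commute[of k])
       (simp add: power_mult)
  also have "8 * ((norm (\<gamma> i))\<^sup>2 / 4 ^ k) \<le> 8 * B\<^sup>2 / 4 ^ k"
    using power_mono[OF B, of i 2] by (simp add: divide_right_mono)
  finally show ?thesis .
qed (auto simp: cc_mask_def shape_mask_def)

theorem theorem4p6:
  fixes f0 :: "int \<Rightarrow> real" and c :: real and eps :: "nat \<Rightarrow> int \<Rightarrow> real"
  assumes "c > 0"
    and "admissible_eps c eps f0"
    and "\<exists>B. \<forall>k n. norm (nucc_gamma eps f0 k n) \<le> B"
    and "\<forall>k j. \<forall>n \<in> {-2, -1, 0, 1}.
           cc_mask n - 1/4 < nucc_mask eps f0 k j n \<and> nucc_mask eps f0 k j n < cc_mask n + 1/4"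
  shows "C1_scheme (nucc_scheme eps f0)"
proof -
  obtain B where B: "\<And>k n. norm (nucc_gamma eps f0 k n) \<le> B" using assms(3) by blast
  have near: "\<bar>nucc_mask eps f0 k j n - cc_mask n\<bar> \<le> 1/4" if "n \<in> {-2, -1, 0, 1}" for k j n
    using assms(4) that by (smt (verit))
  interpret perturbed_corner_cutting "nucc_mask eps f0" "8 * B\<^sup>2"
  proof
    show "nucc_mask eps f0 k j n = 0" if "n \<notin> {-2, -1, 0, 1}" for k j n
      using that by (simp add: nucc_mask_def shape_mask_def)
    show "\<bar>nucc_mask eps f0 k j n - cc_mask n\<bar> \<le> 8 * B\<^sup>2 / 4 ^ k" for k j n
      unfolding nucc_mask_def by (intro shape_mask_near B near[unfolded nucc_mask_def])
  qed
  have "C1_scheme S"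
    by (rule C1_scheme_if_mask_positive) (use assms(4) in blast)
  moreover have "nucc_scheme eps f0 = S"
    by (simp add: nucc_scheme_def fun_eq_iff)
  ultimately show ?thesis by simp
qed

end
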